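(* Let $i,j$ be positive integers and let $0<\alpha<1/2$ (equivalently, $0<\alpha<1/\rho(A_{C_n})$ for every $n\ge 3$). Then $K_{C_n}(\alpha)_{i,j}$ (defined for $n\ge\max(i,j,3)$) converges as $n\to\infty$.
   Context: For a simple graph $G$ with adjacency matrix $A_G$, spectral radius $\rho(A_G)$, and $0<\alpha<1/\rho(A_G)$, the Katz matrix is $K_G(\alpha)=\sum_{t=1}^\infty \alpha^tA_G^t=(I-\alpha A_G)^{-1}-I$, and the Katz similarity index between vertices $i$ and $j$ is the entry $K_G(\alpha)_{i,j}$. $C_n$ is the cycle graph on vertices $1,\dots,n$ with edges $\{i,i+1\}$ for $1\le i<n$ and $\{n,1\}$. *)

theory Defs
  imports Jordan_Normal_Form.Spectral_Radius
begin

text \<open>A graph on the vertex set \<open>{1..n}\<close> is given by \<open>n\<close> and its set of edges,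
  each edge being a two-element set of vertices.\<close>

definition simple_graph :: "nat \<Rightarrow> nat set set \<Rightarrow> bool" where
  "simple_graph n E \<longleftrightarrow> (\<forall>e\<in>E. e \<subseteq> {1..n} \<and> card e = 2)"

text \<open>Vertices are numbered from 1, rows and columns from 0, whence the shift by one.\<close>

definition adj_mat :: "nat \<Rightarrow> nat set set \<Rightarrow> real mat" where
  "adj_mat n E = mat n n (\<lambda>(a, b). if {Suc a, Suc b} \<in> E then 1 else 0)"

definition graph_spectral_radius :: "nat \<Rightarrow> nat set set \<Rightarrow> real" where
  "graph_spectral_radius n E = spectral_radius (map_mat complex_of_real (adj_mat n E))"

text \<open>The sum of the matrices \<open>\<alpha>\<^sup>t A\<^sup>t\<close> over \<open>t \<ge> 1\<close>, taken entrywise. It is meaningful only where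
  the series converges, in particular for \<open>0 < \<alpha> < 1 / \<rho>(A)\<close>.\<close>

definition katz_mat :: "nat \<Rightarrow> nat set set \<Rightarrow> real \<Rightarrow> real mat" where
  "katz_mat n E \<alpha> =
     mat n n (\<lambda>(a, b). \<Sum>t. (\<alpha> ^ Suc t \<cdot>\<^sub>m (adj_mat n E ^\<^sub>m Suc t)) $$ (a, b))"

text \<open>The arguments \<open>i\<close>, \<open>j\<close> are vertices in \<open>{1..n}\<close>.\<close>

definition katz_index :: "nat \<Rightarrow> nat set set \<Rightarrow> real \<Rightarrow> nat \<Rightarrow> nat \<Rightarrow> real" where
  "katz_index n E \<alpha> i j = katz_mat n E \<alpha> $$ (i - 1, j - 1)"

definition cycle_edges :: "nat \<Rightarrow> nat set set" where
  "cycle_edges n = {{i, i + 1} | i. 1 \<le> i \<and> i < n} \<union> {{n, 1}}"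

lemma simple_graph_cycle: "n \<ge> 3 \<Longrightarrow> simple_graph n (cycle_edges n)"
  by (auto simp: simple_graph_def cycle_edges_def card_insert_if)

end

(* Unrolling the cycle onto the integers turns the number of walks of length t from a into a
   solution of u_(t+1)(b) = u_t(b-1) + u_t(b+1), whose dependence on n sits only in the
   n-periodic initial datum. At each fixed b that datum is eventually constant in n, so every
   term of the Katz series converges. The number of walks is at most 2^t, so the geometric
   series in 2 alpha dominates and the limit may be taken termwise (Tannery). *)

theory Submission
  imports Defs "HOL-Analysis.Uniform_Limit"
begin

text \<open>The endpoint \<open>b\<close> ranges over all integers, so the recursion has no special
  case where the cycle closes up; \<open>n\<close> enters only through the base case, the indicator
  of the residue class of \<open>a\<close>.\<close>

fun cycle_walks :: "nat \<Rightarrow> int \<Rightarrow> nat \<Rightarrow> int \<Rightarrow> real" where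
  "cycle_walks n a 0 b = of_bool (int n dvd b - a)"
| "cycle_walks n a (Suc t) b = cycle_walks n a t (b - 1) + cycle_walks n a t (b + 1)"

lemma cycle_walks_nonneg: "cycle_walks n a t b \<ge> 0"
  by (induction t arbitrary: b) auto

lemma cycle_walks_le: "cycle_walks n a t b \<le> 2 ^ t"
proof (induction t arbitrary: b)
  case (Suc t)
  show ?case
    using Suc[of "b - 1"] Suc[of "b + 1"] by simp
qed auto

lemma convergent_cycle_walks: "convergent (\<lambda>n. cycle_walks n a t b)"
proof (induction t arbitrary: b)
  case 0
  have "eventually (\<lambda>n. cycle_walks n a 0 b = of_bool (b = a)) sequentially"
    \<comment> \<open>Once n exceeds the distance of a and b, the only multiple of n that b - a can
      be is 0.\<close>
    using eventually_gt_at_top[of "nat \<bar>b - a\<bar>"]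
  proof eventually_elim
    case (elim n)
    then show ?case
      using dvd_imp_le_int[of "b - a" "int n"] by auto
  qed
  then show ?case
    by (intro convergentI) (rule tendsto_eventually)
next
  case (Suc t)
  then show ?case
    by (simp add: convergent_add)
qed

lemma adj_mat_carrier [simp]: "adj_mat n E \<in> carrier_mat n n"
  by (simp add: adj_mat_def)

lemma adj_mat_sym:
  assumes "k < n" and "l < n"
  shows "adj_mat n E $$ (k, l) = adj_mat n E $$ (l, k)"
  using assms by (simp add: adj_mat_def insert_commute)

text \<open>Puts adjacency into the residue form matching the recursion of
  \<open>cycle_walks\<close>: with indices from 0, the closing edge {n, 1} becomes the wrap-around
  between n - 1 and 0.\<close>

lemma cycle_edges_iff:
  assumes "n \<ge> 3" and "k < n" and "l < n"
  shows "{Suc k, Suc l} \<in> cycle_edges n \<longleftrightarrow>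
    k = nat ((int l + 1) mod int n) \<or> k = nat ((int l - 1) mod int n)"
proof -
  have succ: "nat ((int l + 1) mod int n) = (if Suc l = n then 0 else Suc l)"
    using assms by (auto simp: nat_mod_distrib nat_add_distrib)
  have pred: "nat ((int l - 1) mod int n) = (if l = 0 then n - 1 else l - 1)"
    using assms by (auto simp: zmod_minus1 nat_diff_distrib)
  show ?thesis
    unfolding succ pred using assms
    by (auto simp: cycle_edges_def doubleton_eq_iff)
qed

text \<open>Each column of the matrix has exactly two ones, at the neighbours of its index. Letting
  \<open>f\<close> take values in any real algebra covers both the real matrix powers and the
  complex eigenvectors.\<close>

lemma sum_adj_mat_cycle:
  fixes f :: "nat \<Rightarrow> 'a::real_algebra_1" and b :: int
  assumes "n \<ge> 3"
  shows "(\<Sum>k<n. of_real (adj_mat n (cycle_edges n) $$ (k, nat (b mod int n))) * f k)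
    = f (nat ((b - 1) mod int n)) + f (nat ((b + 1) mod int n))"
proof -
  define l p s where "l = nat (b mod int n)" and "p = nat ((b - 1) mod int n)"
    and "s = nat ((b + 1) mod int n)"
  have l: "l < n" and p: "p < n" and s: "s < n"
    using assms by (auto simp: l_def p_def s_def nat_less_iff)
  \<comment> \<open>If the two neighbours coincided, n would divide 2, and the sum would collapse to
    a single term.\<close>
  have "p \<noteq> s"
  proof
    assume "p = s"
    then have "(b - 1) mod int n = (b + 1) mod int n"
      using assms by (simp add: p_def s_def eq_nat_nat_iff)
    then have "int n dvd 2"
      by (simp add: mod_eq_dvd_iff)
    then show False
      using assms zdvd_imp_le by fastforce
  qed
  have shift: "nat ((int l + 1) mod int n) = s" "nat ((int l - 1) mod int n) = p"
    using assms by (auto simp: l_def s_def p_def mod_simps)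
  have "(\<Sum>k<n. of_real (adj_mat n (cycle_edges n) $$ (k, l)) * f k)
    = (\<Sum>k<n. if k \<in> {p, s} then f k else 0)"
    using l cycle_edges_iff[OF assms _ l] by (intro sum.cong) (auto simp: adj_mat_def shift)
  also have "\<dots> = (\<Sum>k\<in>{..<n} \<inter> {p, s}. f k)"
    by (simp add: sum.inter_restrict)
  also have "{..<n} \<inter> {p, s} = {p, s}"
    using p s by auto
  finally show ?thesis
    using \<open>p \<noteq> s\<close> by (simp add: l_def p_def s_def)
qed

text \<open>Reduction mod n carries the neighbours of b on the integer line to the neighbours of its
  residue on the cycle. Stating this for every integer b lets the induction pass to b - 1 and b + 1
  without range conditions.\<close>

lemma adj_mat_cycle_pow:
  assumes "n \<ge> 3" and "a < n"
  shows "(adj_mat n (cycle_edges n) ^\<^sub>m t) $$ (a, nat (b mod int n)) = cycle_walks n (int a) t b"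
proof (induction t arbitrary: b)
  let ?A = "adj_mat n (cycle_edges n)"
  have dim: "dim_row ?A = n" "dim_col ?A = n"
    by (simp_all add: adj_mat_def)
  have b: "nat (b mod int n) < n" for b
    using assms by (simp add: nat_less_iff)
  {
    case 0
    have "a = nat (b mod int n) \<longleftrightarrow> int n dvd b - int a"
      using assms mod_eq_dvd_iff[of b "int n" "int a"] by (auto simp: nat_eq_iff)
    then show ?case
      using assms b by (simp add: dim)
  next
    case (Suc t)
    \<comment> \<open>The new factor of the power stands on the right, so its column at b mod n
      appears. Here \<open>of_real\<close> is the identity and only fits the shape of
      \<open>sum_adj_mat_cycle\<close>.\<close>
    have "(?A ^\<^sub>m Suc t) $$ (a, nat (b mod int n))
      = (\<Sum>k<n. of_real (?A $$ (k, nat (b mod int n))) * (?A ^\<^sub>m t) $$ (a, k))"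
      using assms b by (simp add: dim scalar_prod_def lessThan_atLeast0 mult.commute)
    also have "\<dots> = cycle_walks n (int a) (Suc t) b"
      unfolding sum_adj_mat_cycle[OF assms(1)] by (simp add: Suc)
    finally show ?case .
  }
qed

lemma mult_adj_mat_cycle_vec:
  assumes "n \<ge> 3" and "l < n" and v: "v \<in> carrier_vec n"
  shows "(map_mat complex_of_real (adj_mat n (cycle_edges n)) *\<^sub>v v) $ l
    = v $ nat ((int l - 1) mod int n) + v $ nat ((int l + 1) mod int n)"
proof -
  let ?A = "adj_mat n (cycle_edges n)"
  have dim: "dim_row ?A = n" "dim_col ?A = n"
    by (simp_all add: adj_mat_def)
  have "(map_mat complex_of_real ?A *\<^sub>v v) $ l = (\<Sum>k<n. of_real (?A $$ (l, k)) * v $ k)"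
    using assms by (simp add: dim scalar_prod_def lessThan_atLeast0)
  \<comment> \<open>Symmetry turns row l into column l, where the column sum formula
    applies.\<close>
  also have "\<dots> = (\<Sum>k<n. of_real (?A $$ (k, nat (int l mod int n))) * v $ k)"
    using assms by (intro sum.cong) (auto simp: adj_mat_sym[of l])
  finally show ?thesis
    by (simp add: sum_adj_mat_cycle[OF assms(1)])
qed

lemma eigenvalue_cycle_two:
  assumes "n \<ge> 3"
  shows "eigenvalue (map_mat complex_of_real (adj_mat n (cycle_edges n))) 2"
proof -
  let ?A = "map_mat complex_of_real (adj_mat n (cycle_edges n))"
  \<comment> \<open>The all-ones vector is an eigenvector because every vertex has degree 2.\<close>
  let ?v = "Matrix.vec n (\<lambda>_. 1 :: complex)"
  have dim: "dim_row ?A = n"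
    by (simp add: adj_mat_def)
  have "?A *\<^sub>v ?v = 2 \<cdot>\<^sub>v ?v"
  proof (rule eq_vecI)
    fix l assume "l < dim_vec (2 \<cdot>\<^sub>v ?v)"
    then show "(?A *\<^sub>v ?v) $ l = (2 \<cdot>\<^sub>v ?v) $ l"
      using assms by (subst mult_adj_mat_cycle_vec) (auto simp: nat_less_iff)
  qed (simp add: adj_mat_def)
  moreover have "?v \<noteq> 0\<^sub>v n"
    using assms by (metis index_vec index_zero_vec(1) zero_neq_one not_numeral_le_zero not_gr_zero)
  ultimately show ?thesis
    unfolding eigenvalue_def eigenvector_def dim by (intro exI[of _ ?v]) simp
qed

text \<open>At a coordinate where an eigenvector has maximal modulus M > 0, the eigenvalue equation
  gives |x| M \<le> 2 M, the right side bounding the two neighbouring entries.\<close>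

lemma norm_eigenvalue_cycle_le:
  assumes "n \<ge> 3" and "eigenvalue (map_mat complex_of_real (adj_mat n (cycle_edges n))) x"
  shows "norm x \<le> 2"
proof -
  let ?A = "map_mat complex_of_real (adj_mat n (cycle_edges n))"
  have dim: "dim_row ?A = n"
    by (simp add: adj_mat_def)
  obtain v where v: "v \<in> carrier_vec n" "v \<noteq> 0\<^sub>v n" "?A *\<^sub>v v = x \<cdot>\<^sub>v v"
    using assms(2) unfolding eigenvalue_def eigenvector_def dim by blast
  define M where "M = Max ((\<lambda>k. norm (v $ k)) ` {..<n})"
  have le: "norm (v $ k) \<le> M" if "k < n" for k
    unfolding M_def using that by (intro Max_ge) auto
  have "M \<in> (\<lambda>k. norm (v $ k)) ` {..<n}"
    unfolding M_def using assms by (intro Max_in) (auto simp: lessThan_empty_iff)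
  then obtain l where l: "l < n" "M = norm (v $ l)"
    by auto
  obtain k where "k < n" "v $ k \<noteq> 0"
    using v eq_vecI[of v "0\<^sub>v n"] by auto
  then have "M > 0"
    using le[of k] by (meson less_le_trans zero_less_norm_iff)
  have "norm x * M = norm ((?A *\<^sub>v v) $ l)"
    using v l by (simp add: norm_mult)
  also have "\<dots> \<le> M + M"
    unfolding mult_adj_mat_cycle_vec[OF assms(1) l(1) v(1)]
    using assms by (intro norm_triangle_mono le) (auto simp: nat_less_iff)
  finally show ?thesis
    using \<open>M > 0\<close> by simp
qed

text \<open>Identifies the bound 1/\<rho> with 1/2 for all n \<ge> 3 at once, which gives the
  equivalence of the two conditions on \<alpha>.\<close>

lemma graph_spectral_radius_cycle:
  assumes "n \<ge> 3"
  shows "graph_spectral_radius n (cycle_edges n) = 2"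
proof -
  let ?A = "map_mat complex_of_real (adj_mat n (cycle_edges n))"
  have A: "?A \<in> carrier_mat n n"
    by simp
  have "Max (norm ` spectrum ?A) = 2"
  proof (rule Max_eqI)
    show "finite (norm ` spectrum ?A)"
      using card_finite_spectrum(1)[OF A] by simp
    show "y \<le> 2" if "y \<in> norm ` spectrum ?A" for y
      using that norm_eigenvalue_cycle_le[OF assms] by (auto simp: spectrum_def)
    show "2 \<in> norm ` spectrum ?A"
      using eigenvalue_cycle_two[OF assms] by (force simp: spectrum_def)
  qed
  then show ?thesis
    by (simp add: graph_spectral_radius_def spectral_radius_def)
qed

text \<open>The two series agree term by term, so no bound on \<alpha> is involved. Since j - 1 < n,
  reducing it mod n changes nothing.\<close>

lemma katz_index_cycle:
  assumes "n \<ge> 3" and "1 \<le> i" and "i \<le> n" and "1 \<le> j" and "j \<le> n"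
  shows "katz_index n (cycle_edges n) \<alpha> i j
    = (\<Sum>t. \<alpha> ^ Suc t * cycle_walks n (int (i - 1)) (Suc t) (int (j - 1)))"
proof -
  let ?A = "adj_mat n (cycle_edges n)"
  have ij: "i - 1 < n" "j - 1 < n"
    using assms by auto
  have dim: "dim_row ?A = n" "dim_col ?A = n"
    by (simp_all add: adj_mat_def)
  have "(?A ^\<^sub>m t) $$ (i - 1, j - 1) = cycle_walks n (int (i - 1)) t (int (j - 1))" for t
    using adj_mat_cycle_pow[OF assms(1) ij(1), of t "int (j - 1)"] ij by simp
  moreover have "(\<alpha> ^ Suc t \<cdot>\<^sub>m ?A ^\<^sub>m Suc t) $$ (i - 1, j - 1)
      = \<alpha> ^ Suc t * (?A ^\<^sub>m Suc t) $$ (i - 1, j - 1)" for t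
    by (rule index_smult_mat(1)) (use ij dim in auto)
  ultimately show ?thesis
    unfolding katz_index_def katz_mat_def using ij
    by (simp del: cycle_walks.simps pow_mat.simps power_Suc)
qed

lemma convergent_katz_index_cycle:
  fixes \<alpha> :: real
  assumes "1 \<le> i" and "1 \<le> j" and "0 < \<alpha>" and "\<alpha> < 1 / 2"
  shows "convergent (\<lambda>n. katz_index n (cycle_edges n) \<alpha> i j)"
proof -
  let ?u = "\<lambda>t n. \<alpha> ^ Suc t * cycle_walks n (int (i - 1)) (Suc t) (int (j - 1))"
  have "convergent (?u t)" for t
    by (intro convergent_mult convergent_const convergent_cycle_walks)
  \<comment> \<open>Only the existence of the termwise limits matters; their values are never
    computed.\<close>
  then have lim: "?u t \<longlonglongrightarrow> lim (?u t)" for t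
    by (simp add: convergent_LIMSEQ_iff)
  have bound: "norm (?u t n) \<le> (2 * \<alpha>) ^ Suc t" for t n
  proof -
    have "norm (?u t n) = ?u t n"
      using assms(3) cycle_walks_nonneg by (simp del: cycle_walks.simps)
    also have "\<dots> \<le> \<alpha> ^ Suc t * 2 ^ Suc t"
      using assms(3) by (intro mult_left_mono cycle_walks_le) simp
    finally show ?thesis
      by (simp add: power_mult_distrib mult_ac)
  qed
  \<comment> \<open>The dominating series is independent of n, and its ratio 2 \<alpha> is below 1
    exactly because \<alpha> < 1/2.\<close>
  have "summable (\<lambda>t. (2 * \<alpha>) ^ Suc t)"
    unfolding summable_Suc_iff using assms by (intro summable_geometric) simp
  then have "(\<lambda>n. \<Sum>t. ?u t n) \<longlonglongrightarrow> (\<Sum>t. lim (?u t))"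
    using tannerys_theorem[where a = ?u and M = "\<lambda>t. (2 * \<alpha>) ^ Suc t", OF lim] bound
    by (simp add: always_eventually case_prod_unfold del: cycle_walks.simps power_Suc)
  \<comment> \<open>For smaller n the cycle is degenerate or the entry lies outside the matrix;
    finitely many such n do not affect the limit.\<close>
  moreover have "eventually (\<lambda>n. (\<Sum>t. ?u t n) = katz_index n (cycle_edges n) \<alpha> i j) sequentially"
    using eventually_ge_at_top[of "max 3 (max i j)"]
    by eventually_elim (use assms in \<open>simp add: katz_index_cycle del: cycle_walks.simps power_Suc\<close>)
  ultimately show ?thesis
    by (intro convergentI) (rule Lim_transform_eventually)
qed

theorem theorem6:
  fixes \<alpha> :: real and i j :: nat
  assumes "i \<ge> 1" and "j \<ge> 1"
  shows "((0 < \<alpha> \<and> \<alpha> < 1 / 2) \<longleftrightarrow>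
           (\<forall>n\<ge>3. 0 < \<alpha> \<and> \<alpha> < 1 / graph_spectral_radius n (cycle_edges n))) \<and>
         (0 < \<alpha> \<and> \<alpha> < 1 / 2 \<longrightarrow> convergent (\<lambda>n. katz_index n (cycle_edges n) \<alpha> i j))"
  using assms convergent_katz_index_cycle by (auto simp: graph_spectral_radius_cycle)

end
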